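(* Let $p>q>1$ be coprime integers. The generating function of the complexity function $P_{\Xi_{p/q}}$ is $$f_{p/q}(z)=\sum_{n=0}^{\infty}P_{\Xi_{p/q}}(n)z^n=\frac{1+(pq-p-q)z}{(1-pz)(1-qz)}$$ (as formal power series).
   Context: For $n\ge 2$ let $\Sigma_n=\{0,1,\dots,n-1\}$. For a finite alphabet $A$ and $X\subseteq A^{\mathbb{Z}}$, the complexity function $P_X(n)$, $n\ge 0$, is the number of words of length $n$ over $A$ that occur as subwords $x[i]x[i+1]\cdots x[i+n-1]$ of elements $x\in X$ (for nonempty $X$, $P_X(0)=1$, counting the empty word). For coprime integers $s,t>1$, write $a,b\in\Sigma_{st}$ uniquely as $a=a_1t+a_0$, $b=b_1t+b_0$ with $a_0,b_0\in\Sigma_t$, $a_1,b_1\in\Sigma_s$, and put $g_{s,st}(a,b)=a_0s+b_1$. For digits $a,c,b\in\Sigma_{st}$ let $h_{s/t}(a,c,b)=g_{s,st}(g_{s,st}(a,c),g_{s,st}(c,b))$. The multiplication automaton $\Pi_{s/t,st}:\Sigma_{st}^{\mathbb{Z}}\to\Sigma_{st}^{\mathbb{Z}}$ is $\Pi_{s/t,st}(x)[i]=h_{s/t}(x[i-1],x[i],x[i+1])$; it is a bijection with inverse $\Pi_{t/s,st}$ and it multiplies by $s/t$ in base $st$. The trace of $x\in\Sigma_{st}^{\mathbb{Z}}$ is $\mathrm{Tr}_{s/t}(x)\in\Sigma_{st}^{\mathbb{Z}}$, $\mathrm{Tr}_{s/t}(x)[k]=\Pi_{s/t,st}^k(x)[0]$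 for $k\in\mathbb{Z}$, and the trace subshift is $\Xi_{s/t}=\mathrm{Tr}_{s/t}(\Sigma_{st}^{\mathbb{Z}})$. *)

theory Defs
  imports Complex_Main "HOL-Computational_Algebra.Formal_Power_Series"
begin

text \<open>Digits are natural numbers; the alphabet of size \<open>n\<close> is \<open>{..<n}\<close>, and bi-infinite
  words over \<open>A\<close> are functions on the integers with values in \<open>A\<close>.\<close>

definition full_shift :: "'a set \<Rightarrow> (int \<Rightarrow> 'a) set" where
  "full_shift A = {x. \<forall>i. x i \<in> A}"

definition words_of :: "(int \<Rightarrow> 'a) set \<Rightarrow> nat \<Rightarrow> 'a list set" where
  "words_of X n = {map (\<lambda>j. x (i + int j)) [0..<n] | x i. x \<in> X}"

definition complexity :: "(int \<Rightarrow> 'a) set \<Rightarrow> nat \<Rightarrow> nat" where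
  "complexity X n = card (words_of X n)"

text \<open>\<open>mult_digit s t\<close> is the local rule \<open>g\<close> of multiplication by \<open>s\<close> in base \<open>s * t\<close>. For a digit
  \<open>a < s * t\<close>, the decomposition \<open>a = a\<^sub>1 * t + a\<^sub>0\<close> with \<open>a\<^sub>0 < t\<close>, \<open>a\<^sub>1 < s\<close> is given by
  \<open>a\<^sub>0 = a mod t\<close> and \<open>a\<^sub>1 = a div t\<close>.\<close>

definition mult_digit :: "nat \<Rightarrow> nat \<Rightarrow> nat \<Rightarrow> nat \<Rightarrow> nat" where
  "mult_digit s t a b = (a mod t) * s + b div t"

definition frac_digit :: "nat \<Rightarrow> nat \<Rightarrow> nat \<Rightarrow> nat \<Rightarrow> nat \<Rightarrow> nat" where
  "frac_digit s t a c b = mult_digit s t (mult_digit s t a c) (mult_digit s t c b)"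

definition mult_automaton :: "nat \<Rightarrow> nat \<Rightarrow> (int \<Rightarrow> nat) \<Rightarrow> (int \<Rightarrow> nat)" where
  "mult_automaton s t x = (\<lambda>i. frac_digit s t (x (i - 1)) (x i) (x (i + 1)))"

text \<open>Integer iterates of a bijection \<open>F\<close> of \<open>S\<close>; the inverse has to be taken on \<open>S\<close> because
  \<open>mult_automaton s t\<close> is injective only on the full shift over \<open>{..<s * t}\<close>.\<close>

definition int_iterate :: "'b set \<Rightarrow> ('b \<Rightarrow> 'b) \<Rightarrow> int \<Rightarrow> 'b \<Rightarrow> 'b" where
  "int_iterate S F k = (if 0 \<le> k then F ^^ nat k else inv_into S F ^^ nat (- k))"

definition mult_trace :: "nat \<Rightarrow> nat \<Rightarrow> (int \<Rightarrow> nat) \<Rightarrow> (int \<Rightarrow> nat)" where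
  "mult_trace s t x = (\<lambda>k. int_iterate (full_shift {..<s * t}) (mult_automaton s t) k x 0)"

definition trace_subshift :: "nat \<Rightarrow> nat \<Rightarrow> (int \<Rightarrow> nat) set" where
  "trace_subshift s t = mult_trace s t ` full_shift {..<s * t}"

lemma mult_digit_less:
  assumes "a < s * t" "b < s * t"
  shows "mult_digit s t a b < s * t"
proof -
  have t: "t > 0" using assms by (cases t) auto
  have "a mod t < t" "b div t < s"
    using t assms by (auto simp: less_mult_imp_div_less)
  then have "Suc (a mod t) * s \<le> t * s" by (intro mult_right_mono) auto
  with \<open>b div t < s\<close> show ?thesis by (simp add: mult_digit_def mult.commute)
qed

lemma mult_digit_mult_digit:
  assumes "a < s * t" "b < s * t" "c < s * t"
  shows "mult_digit t s (mult_digit s t a b) (mult_digit s t b c) = b"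
proof -
  have "b div t < s" "c div t < s"
    using assms by (auto simp: less_mult_imp_div_less)
  then show ?thesis by (simp add: mult_digit_def div_mult_mod_eq)
qed

lemma mult_automaton_in_full_shift:
  "x \<in> full_shift {..<s * t} \<Longrightarrow> mult_automaton s t x \<in> full_shift {..<s * t}"
  by (simp add: full_shift_def mult_automaton_def frac_digit_def mult_digit_less)

lemma mult_automaton_inverse:
  assumes "x \<in> full_shift {..<s * t}"
  shows "mult_automaton t s (mult_automaton s t x) = x"
proof
  fix i
  have x: "x j < s * t" for j using assms by (simp add: full_shift_def)
  define y where "y = (\<lambda>j. mult_digit s t (x j) (x (j + 1)))"
  have y: "y j < s * t" for j by (simp add: y_def mult_digit_less x)
  have F: "mult_automaton s t x j = mult_digit s t (y (j - 1)) (y j)" for j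
    by (simp add: mult_automaton_def frac_digit_def y_def)
  have "mult_digit t s (mult_automaton s t x j) (mult_automaton s t x (j + 1)) = y j" for j
    using mult_digit_mult_digit[OF y y y, of "j - 1" j "j + 1"] by (simp add: F)
  from this[of "i - 1"] this[of i]
  have "mult_automaton t s (mult_automaton s t x) i = mult_digit t s (y (i - 1)) (y i)"
    by (simp add: mult_automaton_def[of t s] frac_digit_def)
  also have "\<dots> = x i"
    using mult_digit_mult_digit[OF x x x, of "i - 1" i "i + 1"] by (simp add: y_def)
  finally show "mult_automaton t s (mult_automaton s t x) i = x i" .
qed

lemma bij_betw_mult_automaton:
  "bij_betw (mult_automaton s t) (full_shift {..<s * t}) (full_shift {..<s * t})"
  by (rule bij_betwI[where g = "mult_automaton t s"])
    (use mult_automaton_in_full_shift[of _ s t] mult_automaton_in_full_shift[of _ t s]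
      mult_automaton_inverse[of _ s t] mult_automaton_inverse[of _ t s]
      in \<open>auto simp: mult.commute\<close>)

end

theory Submission
  imports Defs
begin

text \<open>The automaton multiplies by \<open>\<rho> = p/q\<close>, so the words of length \<open>n\<close> of the trace subshift are the
  sequences of units digits of \<open>r, \<rho> r, \<dots>, \<rho>\<^sup>n\<^sup>-\<^sup>1 r\<close> in base \<open>p q\<close> for real \<open>r\<close>. Such a word is periodic
  in \<open>r\<close> with period \<open>p q\<^sup>n\<close>, is constant on the cells cut out by the points \<open>r\<close> at which some
  \<open>\<rho>\<^sup>j r\<close> with \<open>j < n\<close> is an integer, and different cells within a period carry different words. So
  the complexity counts these points in \<open>[0, p q\<^sup>n)\<close>; sorting them by the smallest such \<open>j\<close> gives
  the recurrence \<open>P(n + 1) = q P(n) + q (p - 1) p\<^sup>n\<close>, which is the claimed generating function.\<close>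

section \<open>Base \<open>p * q\<close> expansions of reals under the automaton\<close>

text \<open>Position \<open>i\<close> has weight \<open>B powi (- i)\<close>, so position 0 holds
  the units digit and fractional digits lie to the right. Floor and \<open>mod\<close> extend this
  to negative \<open>r\<close>.\<close>

definition digits :: "nat \<Rightarrow> real \<Rightarrow> int \<Rightarrow> nat" where
  "digits B r i = nat (\<lfloor>r * of_nat B powi i\<rfloor> mod int B)"

lemma digits_in_full_shift: "B > 0 \<Longrightarrow> digits B r \<in> full_shift {..<B}"
  by (auto simp: full_shift_def digits_def nat_less_iff)

text \<open>All digits involved come from \<open>n\<close>, the floor of \<open>p * t\<close> with
  \<open>t = r * (p * q) powi i\<close>. The low part of the left digit is
  \<open>(n div p) mod q\<close>, the high part of the right digit is \<open>n mod p\<close>, and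
  together they form \<open>n mod (p * q)\<close>.\<close>

lemma mult_digit_digits:
  assumes "p > 0" "q > 0"
  shows "mult_digit p q (digits (p * q) r i) (digits (p * q) r (i + 1))
    = digits (p * q) (of_nat p * r) i"
proof -
  define t where "t = r * of_nat (p * q) powi i"
  have t1: "r * of_nat (p * q) powi (i + 1) = t * of_nat (p * q)"
    using assms by (simp add: t_def power_int_add mult_ac)
  have dg: "int (digits (p * q) s j) = \<lfloor>s * of_nat (p * q) powi j\<rfloor> mod int (p * q)" for s j
    using assms by (simp add: digits_def del: of_nat_mult)
  define n where "n = \<lfloor>of_nat p * t\<rfloor>"
  have A: "\<lfloor>t * of_nat (p * q)\<rfloor> div int q = n"
    using floor_divide_real_eq_div[of "int q" "t * of_nat (p * q)"] assms by (simp add: n_def mult_ac)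
  have B: "\<lfloor>t\<rfloor> = n div int p"
    using floor_divide_real_eq_div[of "int p" "of_nat p * t"] assms by (simp add: n_def)
  have "int (mult_digit p q (digits (p * q) r i) (digits (p * q) r (i + 1)))
      = (\<lfloor>t\<rfloor> mod int (p * q)) mod int q * int p + (\<lfloor>t * of_nat (p * q)\<rfloor> mod int (p * q)) div int q"
    by (simp add: mult_digit_def dg t1 zdiv_int zmod_int of_nat_mult[where 'a = int]
        del: of_nat_mult flip: t_def)
  also have "(\<lfloor>t\<rfloor> mod int (p * q)) mod int q = (n div int p) mod int q"
    by (simp add: B mod_mod_cancel)
  also have "(\<lfloor>t * of_nat (p * q)\<rfloor> mod int (p * q)) div int q = n mod int p"
    using zmod_zmult2_eq[of "int p" "\<lfloor>t * of_nat (p * q)\<rfloor>" "int q"] assms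
    by (simp add: A of_nat_mult[where 'a = int] mult.commute[of "int p"] del: of_nat_mult)
  also have "(n div int p) mod int q * int p + n mod int p = n mod int (p * q)"
    using zmod_zmult2_eq[of "int q" n "int p"] assms by simp
  also have "n = \<lfloor>of_nat p * r * of_nat (p * q) powi i\<rfloor>"
    by (simp add: n_def t_def mult_ac)
  finally show ?thesis
    using assms by (simp add: digits_def)
qed

text \<open>The rule multiplies by \<open>p\<close> twice and reads the result at position
  \<open>i - 1\<close>, which divides by \<open>p * q\<close>; in total this is the factor
  \<open>p / q\<close>.\<close>

lemma mult_automaton_digits:
  assumes "p > 0" "q > 0"
  shows "mult_automaton p q (digits (p * q) r) = digits (p * q) (of_nat p / of_nat q * r)"
proof
  fix i
  have *: "of_nat p * (of_nat p * r) * of_nat (p * q) powi (i - 1)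
      = of_nat p / of_nat q * r * of_nat (p * q) powi i"
    using assms by (simp add: power_int_diff field_simps)
  show "mult_automaton p q (digits (p * q) r) i = digits (p * q) (of_nat p / of_nat q * r) i"
    using mult_digit_digits[OF assms, of r "i - 1"] mult_digit_digits[OF assms, of r i]
      mult_digit_digits[OF assms, of "of_nat p * r" "i - 1"]
    unfolding digits_def * by (simp only: mult_automaton_def frac_digit_def digits_def diff_add_cancel)
qed

lemma mult_automaton_funpow_digits:
  assumes "p > 0" "q > 0"
  shows "(mult_automaton p q ^^ k) (digits (p * q) r) = digits (p * q) ((of_nat p / of_nat q) ^ k * r)"
  by (induction k) (simp_all add: mult_automaton_digits[OF assms] mult_ac)

lemma mult_automaton_funpow_local:
  assumes "\<And>i. \<bar>i\<bar> \<le> int (k + m) \<Longrightarrow> x i = y i" "\<bar>i\<bar> \<le> int m"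
  shows "(mult_automaton s t ^^ k) x i = (mult_automaton s t ^^ k) y i"
  using assms
proof (induction k arbitrary: i m)
  case (Suc k)
  have "(mult_automaton s t ^^ k) x j = (mult_automaton s t ^^ k) y j" if "\<bar>j\<bar> \<le> int (Suc m)" for j
    by (rule Suc.IH[OF _ that]) (use Suc.prems in simp)
  from this[of "i - 1"] this[of i] this[of "i + 1"] Suc.prems(2) show ?case
    by (simp add: mult_automaton_def[of _ _ "(_ ^^ _) _"])
qed simp

text \<open>The real is built digit by digit. To prescribe the digit at \<open>e\<close>, the
  integer \<open>N\<close> encoding all positions up to \<open>e - 1\<close> is kept and everything
  beyond is replaced by \<open>x e\<close>. The earlier digits depend on \<open>N\<close>
  alone.\<close>

lemma digits_approx:
  assumes "x \<in> full_shift {..<B}" "B > 0"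
  shows "\<exists>r. \<forall>i. a \<le> i \<and> i < a + int m \<longrightarrow> digits B r i = x i"
proof (induction m)
  case 0
  then show ?case by simp
next
  case (Suc m)
  then obtain r where r: "\<And>i. a \<le> i \<Longrightarrow> i < a + int m \<Longrightarrow> digits B r i = x i" by blast
  define e where "e = a + int m"
  have xe: "x e < B" using assms by (auto simp: full_shift_def)
  define N where "N = \<lfloor>r * of_nat B powi (e - 1)\<rfloor>"
  define r' :: real where "r' = of_int (N * int B + int (x e)) / of_nat B powi e"
  have re: "r' * of_nat B powi e = of_int (N * int B + int (x e))"
    using assms by (simp add: r'_def)
  have "digits B r' e = x e"
    using xe by (simp add: digits_def re del: of_int_add of_int_mult)
  moreover have "digits B r' i = x i" if i: "a \<le> i" "i < e" for i
  proof -
    define d where "d = nat (e - 1 - i)"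
    have ei: "e = i + 1 + int d" using i by (simp add: d_def)
    have flr: "\<lfloor>s * real B powi i\<rfloor> = \<lfloor>s * real B powi (e - 1)\<rfloor> div int (B ^ d)" for s
    proof -
      have "s * real B powi i = s * real B powi (e - 1) / of_int (int (B ^ d))"
        using assms by (simp add: ei power_int_add)
      then show ?thesis
        using floor_divide_real_eq_div[of "int (B ^ d)" "s * real B powi (e - 1)"] by simp
    qed
    have "r' * real B powi (e - 1) = r' * real B powi e / of_int (int B)"
      using assms by (simp add: power_int_diff)
    then have "\<lfloor>r' * real B powi (e - 1)\<rfloor> = (N * int B + int (x e)) div int B"
      using floor_divide_real_eq_div[of "int B" "r' * real B powi e"]
      by (simp add: re del: of_int_add of_int_mult)
    also have "\<dots> = N" using xe assms by simp
    finally have "\<lfloor>r' * real B powi i\<rfloor> = \<lfloor>r * real B powi i\<rfloor>"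
      by (simp add: flr N_def)
    then show ?thesis using r[of i] i by (simp add: digits_def e_def)
  qed
  ultimately have "digits B r' i = x i" if "a \<le> i" "i < a + int (Suc m)" for i
    using that by (cases "i = e") (simp_all add: e_def)
  then show ?case by blast
qed

section \<open>Words of the trace subshift as units digits of real orbits\<close>

text \<open>A trace read from time \<open>i\<close> on is the forward orbit of the configuration at
  time \<open>i\<close>, so every word of the subshift can be read from time 0 on.\<close>

lemma int_iterate_add:
  assumes "bij_betw F S S" "x \<in> S"
  shows "int_iterate S F (i + int j) x = (F ^^ j) (int_iterate S F i x) \<and> int_iterate S F i x \<in> S"
proof -
  have inS: "int_iterate S F k x \<in> S" for k
  proof -
    have "(F ^^ n) x \<in> S" for n
      using assms by (induction n) (auto simp: bij_betw_def)
    moreover have "(inv_into S F ^^ n) x \<in> S" for n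
      using assms by (induction n) (auto simp: bij_betw_def inv_into_into)
    ultimately show ?thesis by (simp add: int_iterate_def)
  qed
  have step: "int_iterate S F (k + 1) x = F (int_iterate S F k x)" for k
  proof (cases "k \<ge> 0")
    case True
    then have "nat (k + 1) = Suc (nat k)" by simp
    with True show ?thesis by (simp add: int_iterate_def)
  next
    case False
    then have *: "nat (- k) = Suc (nat (- (k + 1)))" by simp
    \<comment> \<open>For \<open>k = -1\<close> the left side falls into the nonnegative branch,
      where zero iterations of either map agree.\<close>
    have "int_iterate S F (k + 1) x = (inv_into S F ^^ nat (- (k + 1))) x"
      using False by (auto simp: int_iterate_def)
    moreover have "int_iterate S F (k + 1) x \<in> F ` S"
      using inS assms by (auto simp: bij_betw_def)
    ultimately show ?thesis
      using False * by (simp add: int_iterate_def f_inv_into_f)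
  qed
  have "int_iterate S F (i + int j) x = (F ^^ j) (int_iterate S F i x)"
  proof (induction j)
    case (Suc j)
    then show ?case using step[of "i + int j"] by (simp add: ac_simps)
  qed simp
  with inS show ?thesis by simp
qed

definition power_word :: "nat \<Rightarrow> nat \<Rightarrow> nat \<Rightarrow> real \<Rightarrow> nat list" where
  "power_word p q n r = map (\<lambda>j. nat (\<lfloor>(of_nat p / of_nat q) ^ j * r\<rfloor> mod int (p * q))) [0..<n]"

lemma words_of_trace_subshift:
  assumes "p > 0" "q > 0"
  shows "words_of (trace_subshift p q) n = range (power_word p q n)"
proof -
  let ?S = "full_shift {..<p * q}" and ?F = "mult_automaton p q"
  note it = int_iterate_add[OF bij_betw_mult_automaton]
  have pw: "power_word p q n r = map (\<lambda>j. (?F ^^ j) (digits (p * q) r) 0) [0..<n]" for r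
    by (simp add: power_word_def mult_automaton_funpow_digits[OF assms] digits_def)
  show ?thesis
  proof (intro equalityI subsetI)
    fix w assume "w \<in> words_of (trace_subshift p q) n"
    then obtain x i where x: "x \<in> ?S" and w: "w = map (\<lambda>j. mult_trace p q x (i + int j)) [0..<n]"
      by (auto simp: words_of_def trace_subshift_def)
    define z where "z = int_iterate ?S ?F i x"
    have "z \<in> ?S" and w': "w = map (\<lambda>j. (?F ^^ j) z 0) [0..<n]"
      using it[OF x, of i] by (auto simp: w z_def mult_trace_def)
    \<comment> \<open>The first \<open>n\<close> iterates at cell 0 depend only on the
      \<open>2 * n + 1\<close> cells from \<open>- n\<close> to \<open>n\<close>, so matching
      \<open>z\<close> there suffices.\<close>
    then obtain r where r: "\<And>j. - int n \<le> j \<Longrightarrow> j < - int n + int (2 * n + 1) \<Longrightarrow> digits (p * q) r j = z j"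
      using digits_approx[of z "p * q" "- int n" "2 * n + 1"] assms by auto
    have "w = power_word p q n r"
      unfolding w' pw
    proof (rule map_cong[OF refl])
      fix j assume "j \<in> set [0..<n]"
      then show "(?F ^^ j) z 0 = (?F ^^ j) (digits (p * q) r) 0"
        by (intro mult_automaton_funpow_local[where m = 0]) (simp_all add: r)
    qed
    then show "w \<in> range (power_word p q n)" by simp
  next
    fix w assume "w \<in> range (power_word p q n)"
    then obtain r where w: "w = power_word p q n r" by auto
    have "digits (p * q) r \<in> ?S" using assms by (simp add: digits_in_full_shift)
    moreover have "w = map (\<lambda>j. mult_trace p q (digits (p * q) r) (0 + int j)) [0..<n]"
      by (simp add: w pw mult_trace_def int_iterate_def)
    ultimately show "w \<in> words_of (trace_subshift p q) n"
      unfolding words_of_def trace_subshift_def by blast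
  qed
qed

section \<open>Cells of constancy and their words\<close>

text \<open>The left ends of the maximal intervals on which \<open>power_word p q n\<close> is constant, in one period.\<close>

definition cell_ends :: "nat \<Rightarrow> nat \<Rightarrow> nat \<Rightarrow> real set" where
  "cell_ends p q n = {r. 0 \<le> r \<and> r < of_nat (p * q ^ n) \<and> (\<exists>j<n. (of_nat p / of_nat q) ^ j * r \<in> \<int>)}"

lemma power_word_eq_imp:
  assumes "p > 0" "q > 0" "coprime p q" "power_word p q n r = power_word p q n r'"
    and "j < n"
    and "0 \<le> r" "r < of_nat (p * q ^ n)" "0 \<le> r'" "r' < of_nat (p * q ^ n)"
  shows "\<lfloor>(of_nat p / of_nat q) ^ j * r\<rfloor> = \<lfloor>(of_nat p / of_nat q) ^ j * r'\<rfloor>"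
proof -
  define N where "N = (\<lambda>j r. \<lfloor>(real p / real q) ^ j * r\<rfloor>)"
  \<comment> \<open>Equal digits make \<open>d\<close> scale exactly by \<open>p / q\<close>, so \<open>p * q dvd d (n - 1)\<close> forces
      \<open>p * q ^ n dvd d 0\<close>, and \<open>d 0\<close> is too small for that unless it vanishes.\<close>
  define d where "d = (\<lambda>j. N j r - N j r')"
  have "N j r mod int (p * q) = N j r' mod int (p * q)" if "j < n" for j
  proof -
    have "power_word p q n r ! j = power_word p q n r' ! j" using assms by simp
    with that show ?thesis using assms
      by (simp add: power_word_def N_def eq_nat_nat_iff)
  qed
  then have dvd: "int (p * q) dvd d j" if "j < n" for j
    using that by (simp add: d_def mod_eq_dvd_iff)
  \<comment> \<open>Since \<rho>^j s / q = \<rho>^(j+1) s / p, the quotients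
    \<open>N j s div q\<close> and \<open>N (Suc j) s div p\<close> agree.\<close>
  have N_Suc: "int p * (N j s div int q) = N (Suc j) s - N (Suc j) s mod int p" for j s
  proof -
    have "N j s div int q = \<lfloor>(real p / real q) ^ j * s / real_of_int (int q)\<rfloor>"
      unfolding N_def by (rule floor_divide_real_eq_div[symmetric]) simp
    also have "(real p / real q) ^ j * s / real_of_int (int q) = (real p / real q) ^ Suc j * s / real_of_int (int p)"
      using assms by simp
    also have "\<lfloor>\<dots>\<rfloor> = N (Suc j) s div int p"
      unfolding N_def by (rule floor_divide_real_eq_div) simp
    finally show ?thesis by (simp add: minus_mod_eq_mult_div)
  qed
  have d_Suc: "int q * d (Suc j) = int p * d j" if "Suc j < n" for j
  proof -
    have "int q dvd d j" "int p dvd d (Suc j)"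
      using dvd[of j] dvd[of "Suc j"] that by (auto dest: dvd_mult_left dvd_mult_right)
    then have "N j r mod int q = N j r' mod int q" "N (Suc j) r mod int p = N (Suc j) r' mod int p"
      by (simp_all add: d_def mod_eq_dvd_iff)
    then have "d j = int q * (N j r div int q - N j r' div int q)"
      and "int p * (N j r div int q - N j r' div int q) = d (Suc j)"
      using N_Suc[of j r] N_Suc[of j r']
      by (simp_all add: d_def right_diff_distrib minus_mod_eq_mult_div[symmetric])
    then show ?thesis by (simp add: mult_ac)
  qed
  have d_pow: "int q ^ j * d j = int p ^ j * d 0" if "j < n" for j
    using that
  proof (induction j)
    case (Suc j)
    have "int q ^ Suc j * d (Suc j) = int q ^ j * (int q * d (Suc j))" by simp
    also have "\<dots> = int p * (int q ^ j * d j)"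
      using Suc.prems by (simp add: d_Suc mult.left_commute)
    also have "\<dots> = int p ^ Suc j * d 0"
      using Suc by (simp add: mult.assoc)
    finally show ?case .
  qed simp
  obtain m where m: "n = Suc m" using \<open>j < n\<close> by (cases n) auto
  have cop: "coprime (int q ^ n) (int p ^ m)" "coprime (int p) (int q ^ n)"
    using assms(3) by (simp_all add: coprime_commute)
  \<comment> \<open>The equal digits at the last index \<open>m\<close> supply one factor
    \<open>q\<close> beyond the \<open>q ^ m\<close> of \<open>d_pow\<close>, hence the full
    \<open>q ^ n\<close>.\<close>
  have "int q dvd d m" using dvd[of m] m by (auto dest: dvd_mult_right)
  then have "int q ^ n dvd int q ^ m * d m" by (auto simp: m mult.commute intro: mult_dvd_mono)
  then have "int q ^ n dvd d 0"
    using d_pow[of m] m cop(1) by (simp add: coprime_dvd_mult_right_iff)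
  moreover have "int p dvd d 0" using dvd[of 0] m by (auto dest: dvd_mult_left)
  ultimately have "int p * int q ^ n dvd d 0"
    using cop by (simp add: divides_mult)
  moreover have "\<bar>d 0\<bar> < int p * int q ^ n"
  proof -
    have "0 \<le> N 0 s \<and> N 0 s < int p * int q ^ n" if "0 \<le> s" "s < of_nat (p * q ^ n)" for s
      using that by (simp add: N_def floor_less_iff)
    from this[of r] this[of r'] show ?thesis using assms by (simp add: d_def abs_less_iff)
  qed
  ultimately have "d 0 = 0"
    using dvd_imp_le_int[of "d 0" "int p * int q ^ n"] by (cases "d 0 = 0") (simp_all add: abs_mult)
  with d_pow[OF \<open>j < n\<close>] assms(2) have "d j = 0" by simp
  then show ?thesis by (simp add: d_def N_def)
qed

text \<open>At a cell end \<open>r\<close> some \<rho>^j r equals its own floor. If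
  \<open>r'\<close> has the same word it has the same floor, so \<rho>^j r \<le> \<rho>^j r' and
  \<open>r\<close> \<le> \<open>r'\<close>; symmetry gives equality.\<close>

lemma inj_on_power_word:
  assumes "p > 0" "q > 0" "coprime p q"
  shows "inj_on (power_word p q n) (cell_ends p q n)"
proof -
  have le: "r \<le> r'" if rr: "r \<in> cell_ends p q n" "r' \<in> cell_ends p q n"
      "power_word p q n r = power_word p q n r'" for r r'
  proof -
    obtain j where j: "j < n" "(real p / real q) ^ j * r \<in> \<int>"
      using rr by (auto simp: cell_ends_def)
    have "(real p / real q) ^ j * r = of_int \<lfloor>(real p / real q) ^ j * r\<rfloor>"
      using j by (auto elim: Ints_cases)
    also have "\<dots> = of_int \<lfloor>(real p / real q) ^ j * r'\<rfloor>"
      using power_word_eq_imp[OF assms rr(3) j(1)] rr by (simp add: cell_ends_def)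
    also have "\<dots> \<le> (real p / real q) ^ j * r'" by simp
    finally show "r \<le> r'"
      using assms by (simp add: mult_le_cancel_left_pos)
  qed
  show ?thesis
    by (intro inj_onI order.antisym le) simp_all
qed

text \<open>Neither reducing \<open>r0\<close> modulo the period nor moving to the left end of its
  cell changes the word.\<close>

lemma range_power_word:
  assumes "p > 0" "q > 0" "n > 0"
  shows "range (power_word p q n) = power_word p q n ` cell_ends p q n"
proof (intro equalityI subsetI)
  fix w assume "w \<in> range (power_word p q n)"
  then obtain r0 where w: "w = power_word p q n r0" by auto
  let ?L = "p * q ^ n"
  define \<rho> where "\<rho> = real p / real q"
  have \<rho>: "\<rho> > 0" using assms by (simp add: \<rho>_def)
  define k where "k = \<lfloor>r0 / of_nat ?L\<rfloor>"
  define r where "r = r0 - of_int k * of_nat ?L"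
  have L: "real ?L > 0" using assms by simp
  have "of_int k \<le> r0 / of_nat ?L" "r0 / of_nat ?L < of_int k + 1"
    by (simp_all add: k_def)
  then have r: "0 \<le> r" "r < of_nat ?L"
    using L by (simp_all only: r_def pos_le_divide_eq pos_divide_less_eq) (simp_all add: algebra_simps)
  \<comment> \<open>the smallest number with the same floors as \<open>r\<close>\<close>
  define s where "s = Max ((\<lambda>j. of_int \<lfloor>\<rho> ^ j * r\<rfloor> / \<rho> ^ j) ` {..<n})"
  have s_ge: "of_int \<lfloor>\<rho> ^ j * r\<rfloor> / \<rho> ^ j \<le> s" if "j < n" for j
    using that by (simp add: s_def)
  have "s \<in> (\<lambda>j. of_int \<lfloor>\<rho> ^ j * r\<rfloor> / \<rho> ^ j) ` {..<n}"
    unfolding s_def using assms by (intro Max_in) auto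
  then obtain j where j: "j < n" "s = of_int \<lfloor>\<rho> ^ j * r\<rfloor> / \<rho> ^ j" by auto
  have "s \<le> r"
    using \<rho> by (simp add: j pos_divide_le_eq mult.commute)
  moreover have "0 \<le> s" using \<rho> r by (simp add: j)
  moreover have "\<rho> ^ j * s \<in> \<int>" using \<rho> by (simp add: j)
  ultimately have "s \<in> cell_ends p q n"
    using r j(1) by (auto simp: cell_ends_def \<rho>_def)
  moreover have "power_word p q n s = w"
    unfolding w power_word_def \<rho>_def[symmetric]
  proof (rule map_cong[OF refl])
    fix i assume "i \<in> set [0..<n]"
    then have i: "i < n" by simp
    have "of_int \<lfloor>\<rho> ^ i * r\<rfloor> \<le> \<rho> ^ i * s"
      using s_ge[OF i] \<rho> by (simp add: pos_divide_le_eq mult.commute)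
    moreover have "\<rho> ^ i * s \<le> \<rho> ^ i * r" using \<open>s \<le> r\<close> \<rho> by simp
    ultimately have "\<lfloor>\<rho> ^ i * s\<rfloor> = \<lfloor>\<rho> ^ i * r\<rfloor>" by linarith
    \<comment> \<open>For \<open>i < n\<close>, multiplying the period \<open>p * q ^ n\<close> by
      \<rho>^i gives \<open>p * q\<close> times the integer \<open>p ^ i * q ^ (n - 1 - i)\<close>,
      so the units digit is unaffected.\<close>
    also have "\<rho> ^ i * r = \<rho> ^ i * r0 - of_int (int (p * q) * (k * int (p ^ i * q ^ (n - 1 - i))))"
    proof -
      have "q ^ n = q ^ i * (q * q ^ (n - 1 - i))"
        using i by (simp flip: power_add power_Suc)
      then show ?thesis using assms(2)
        by (simp add: r_def \<rho>_def right_diff_distrib power_divide)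
    qed
    also have "\<lfloor>\<dots>\<rfloor> mod int (p * q) = \<lfloor>\<rho> ^ i * r0\<rfloor> mod int (p * q)"
      by (simp only: floor_diff_of_int mod_eq_dvd_iff) simp
    finally show "nat (\<lfloor>\<rho> ^ i * s\<rfloor> mod int (p * q)) = nat (\<lfloor>\<rho> ^ i * r0\<rfloor> mod int (p * q))" by simp
  qed
  ultimately show "w \<in> power_word p q n ` cell_ends p q n" by blast
qed auto

section \<open>Counting the cell ends\<close>

text \<open>For \<open>n > 0\<close> the first summand counts the old points in a period that is
  \<open>q\<close> times longer, the second the points where \<rho>^n r is an integer but no earlier
  \<rho>^j r is. The value 1 at 0 stands for the empty word.\<close>

fun word_count :: "nat \<Rightarrow> nat \<Rightarrow> nat \<Rightarrow> nat" where
  "word_count p q 0 = 1"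
| "word_count p q (Suc n) = q * word_count p q n + q * ((p - 1) * p ^ n)"

lemma card_not_dvd_less:
  assumes "p > 0"
  shows "card {k::nat. k < p * l \<and> \<not> p dvd k} = (p - 1) * l"
proof -
  have "bij_betw (\<lambda>(a, b). b * p + a) ({1..<p} \<times> {..<l}) {k. k < p * l \<and> \<not> p dvd k}"
  proof (rule bij_betwI[where g = "\<lambda>k. (k mod p, k div p)"])
    show "(\<lambda>(a, b). b * p + a) \<in> {1..<p} \<times> {..<l} \<rightarrow> {k. k < p * l \<and> \<not> p dvd k}"
    proof
      fix x assume "x \<in> {1..<p} \<times> {..<l}"
      then obtain a b where x: "x = (a, b)" and *: "1 \<le> a" "a < p" "b < l" by auto
      then have "Suc b * p \<le> l * p" by (intro mult_right_mono) auto
      with * show "(\<lambda>(a, b). b * p + a) x \<in> {k. k < p * l \<and> \<not> p dvd k}"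
        by (auto simp: x mult.commute dvd_add_right_iff dest: dvd_imp_le)
    qed
    show "(\<lambda>k. (k mod p, k div p)) \<in> {k. k < p * l \<and> \<not> p dvd k} \<rightarrow> {1..<p} \<times> {..<l}"
      using assms by (auto simp: Pi_iff less_mult_imp_div_less mult.commute dvd_eq_mod_eq_0)
  qed auto
  from bij_betw_same_card[OF this] show ?thesis by simp
qed

text \<open>For \<open>l = 1\<close> this is the set \<open>cell_ends p q (Suc m)\<close> scaled by \<open>p ^ m\<close>. The induction step
  splits off the multiples of \<open>p\<close>, which trades a factor \<open>p\<close> for a factor \<open>q\<close> in the bound; hence \<open>l\<close>.\<close>

lemma card_dvd_power_mixture:
  assumes "p > 0" "q > 0" "coprime p q"
  shows "card {k::nat. k < l * (p * q) ^ Suc m \<and> (\<exists>j\<le>m. q ^ j * p ^ (m - j) dvd k)}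
    = l * word_count p q (Suc m)"
proof (induction m arbitrary: l)
  case 0
  have "{k. k < l * (p * q)} = {..<l * (p * q)}" by auto
  then show ?case using assms
    by simp (simp add: algebra_simps flip: distrib_left)
next
  case (Suc m)
  let ?C = "\<lambda>m l. {k::nat. k < l * (p * q) ^ Suc m \<and> (\<exists>j\<le>m. q ^ j * p ^ (m - j) dvd k)}"
  let ?D = "{k. k < p * (l * q * p ^ Suc m) \<and> \<not> p dvd k}"
  \<comment> \<open>A multiple of \<open>p\<close> loses one factor \<open>p\<close> and satisfies
    the condition for \<open>m\<close>. For any other number only \<open>j = Suc m\<close> is
    possible, so it is \<open>q ^ Suc m\<close> times a number not divisible by
    \<open>p\<close>.\<close>
  have "?C (Suc m) l = (*) p ` ?C m (l * q) \<union> (*) (q ^ Suc m) ` ?D" (is "?L = ?A \<union> ?B")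
  proof (intro equalityI subsetI)
    fix k assume "k \<in> ?L"
    then obtain j where k: "k < l * (p * q) ^ Suc (Suc m)" and j: "j \<le> Suc m" "q ^ j * p ^ (Suc m - j) dvd k"
      by auto
    show "k \<in> ?A \<union> ?B"
    proof (cases "p dvd k")
      case True
      then obtain k' where k': "k = p * k'" by auto
      have "\<exists>j\<le>m. q ^ j * p ^ (m - j) dvd k'"
      proof (cases "j \<le> m")
        case True
        then have "p * (q ^ j * p ^ (m - j)) dvd p * k'"
          using j by (simp add: k' Suc_diff_le mult_ac)
        with True assms show ?thesis by auto
      next
        case False
        with j have "q ^ Suc m dvd p * k'" by (simp add: k' le_Suc_eq)
        then have "q ^ Suc m dvd k'"
          using assms(3) by (metis coprime_commute coprime_dvd_mult_right_iff coprime_power_left_iff)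
        \<comment> \<open>One factor \<open>q\<close> is given up so that the witness
          \<open>j = m\<close> stays within the smaller range.\<close>
        then show ?thesis by (intro exI[of _ m]) (auto dest: dvd_mult_right)
      qed
      moreover have "k' < l * q * (p * q) ^ Suc m"
      proof -
        have "p * k' < p * (l * q * (p * q) ^ Suc m)" using k by (simp add: k' mult_ac)
        then show ?thesis using assms by (simp only: mult_less_cancel1)
      qed
      ultimately show ?thesis unfolding k' by blast
    next
      case False
      have "j = Suc m"
      proof (rule ccontr)
        assume "j \<noteq> Suc m"
        with j have "p dvd q ^ j * p ^ (Suc m - j)" by (simp add: Suc_diff_le)
        with j False show False by (blast intro: dvd_trans)
      qed
      with j obtain M where M: "k = q ^ Suc m * M" by auto
      have "q ^ Suc m * M < q ^ Suc m * (p * (l * q * p ^ Suc m))"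
        using k by (simp add: M power_mult_distrib mult_ac)
      then have "M < p * (l * q * p ^ Suc m)" by (simp only: mult_less_cancel1)
      moreover have "\<not> p dvd M" using False unfolding M by (metis dvd_mult)
      ultimately show ?thesis unfolding M by blast
    qed
  next
    fix k assume "k \<in> ?A \<union> ?B"
    then show "k \<in> ?L"
    proof
      assume "k \<in> ?A"
      then obtain k' j where k: "k = p * k'" "k' < l * q * (p * q) ^ Suc m" "j \<le> m" "q ^ j * p ^ (m - j) dvd k'"
        by auto
      have "p * k' < p * (l * q * (p * q) ^ Suc m)" using k assms by (simp only: mult_less_cancel1)
      then have "k < l * (p * q) ^ Suc (Suc m)" by (simp add: k(1) mult_ac)
      moreover have "q ^ j * p ^ (Suc m - j) dvd k"
        using k mult_dvd_mono[OF dvd_refl k(4), of p] by (simp add: Suc_diff_le mult_ac)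
      ultimately show ?thesis using k(3) by (auto intro!: exI[of _ j])
    next
      assume "k \<in> ?B"
      then obtain M where M: "k = q ^ Suc m * M" "M < p * (l * q * p ^ Suc m)" by auto
      have "q ^ Suc m * M < q ^ Suc m * (p * (l * q * p ^ Suc m))"
        using M assms by (simp only: mult_less_cancel1) simp
      then have "k < l * (p * q) ^ Suc (Suc m)" by (simp add: M(1) power_mult_distrib mult_ac)
      then show ?thesis using M(1) by (auto intro!: exI[of _ "Suc m"])
    qed
  qed
  moreover have "?A \<inter> ?B = {}"
  proof -
    have *: "\<not> p dvd q ^ Suc m * M" if "\<not> p dvd M" for M
      using that assms(3) by (metis coprime_dvd_mult_right_iff coprime_power_right_iff)
    show ?thesis
    proof (rule equals0I)
      fix x assume "x \<in> ?A \<inter> ?B"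
      then obtain k' M where "x = p * k'" "x = q ^ Suc m * M" "\<not> p dvd M" by blast
      then show False using * by (metis dvd_triv_left)
    qed
  qed
  moreover have "card ?A = card (?C m (l * q))"
    using assms by (intro card_image) (auto intro: inj_onI)
  moreover have "card ?B = card ?D"
    using assms by (intro card_image) (auto intro: inj_onI)
  moreover have "finite (?C m (l * q))" "finite ?D" by auto
  ultimately have "card (?C (Suc m) l) = card (?C m (l * q)) + card ?D"
    by (simp only: card_Un_disjoint finite_imageI)
  also have "\<dots> = l * word_count p q (Suc (Suc m))"
    unfolding Suc.IH card_not_dvd_less[OF assms(1)] by (simp add: algebra_simps)
  finally show ?case .
qed

text \<open>If \<rho>^j r is a natural number \<open>N\<close>, then over the common denominator
  \<open>p ^ m\<close> the numerator of \<open>r\<close> is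
  \<open>q ^ j * p ^ (m - j) * N\<close>.\<close>

lemma card_cell_ends:
  assumes "p > 0" "q > 0" "coprime p q" "n > 0"
  shows "card (cell_ends p q n) = word_count p q n"
proof -
  obtain m where n: "n = Suc m" using \<open>n > 0\<close> by (cases n) auto
  let ?C = "{k::nat. k < 1 * (p * q) ^ Suc m \<and> (\<exists>j\<le>m. q ^ j * p ^ (m - j) dvd k)}"
  let ?f = "\<lambda>k::nat. real k / real (p ^ m)"
  have less_iff: "?f k < of_nat (p * q ^ n) \<longleftrightarrow> k < 1 * (p * q) ^ Suc m" for k
  proof -
    have "?f k < of_nat (p * q ^ n) \<longleftrightarrow> real k < real (p * q ^ n * p ^ m)"
      using assms by (simp add: pos_divide_less_eq)
    also have "\<dots> \<longleftrightarrow> k < 1 * (p * q) ^ Suc m"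
      unfolding of_nat_less_iff by (simp add: n power_mult_distrib mult_ac)
    finally show ?thesis .
  qed
  have scale: "(real p / real q) ^ j * ?f (q ^ j * p ^ (m - j) * N) = real N" if "j \<le> m" for j N
    using that assms by (simp add: power_divide field_simps flip: power_add)
  have "cell_ends p q n = ?f ` ?C"
  proof (intro equalityI subsetI)
    fix r assume "r \<in> cell_ends p q n"
    then obtain j where r: "0 \<le> r" "r < of_nat (p * q ^ n)" and j: "j \<le> m" "(real p / real q) ^ j * r \<in> \<int>"
      by (auto simp: cell_ends_def n less_Suc_eq_le)
    then obtain N where N: "(real p / real q) ^ j * r = real N"
      by (metis Ints_cases mult_nonneg_nonneg of_int_0_le_iff of_int_of_nat_eq of_nat_0_le_iff
          zero_le_divide_iff zero_le_imp_eq_int zero_le_power)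
    let ?k = "q ^ j * p ^ (m - j) * N"
    have "r = ?f ?k"
      using N scale[OF j(1), of N] assms
      by (metis divide_eq_0_iff mult_cancel_left of_nat_eq_0_iff power_not_zero less_irrefl)
    moreover have "?k \<in> ?C" using less_iff[of ?k] r j(1) calculation by auto
    ultimately show "r \<in> ?f ` ?C" by blast
  next
    fix r assume "r \<in> ?f ` ?C"
    then obtain k where k: "r = ?f k" "k \<in> ?C" by blast
    then obtain j N where j: "j \<le> m" "k = q ^ j * p ^ (m - j) * N" by (auto simp: dvd_def)
    have "(real p / real q) ^ j * r \<in> \<int>" using scale[OF j(1), of N] j(2) k(1) by simp
    moreover have "r < of_nat (p * q ^ n)" using less_iff[of k] k by simp
    moreover have "0 \<le> r" using k by simp
    ultimately show "r \<in> cell_ends p q n" using j(1) unfolding cell_ends_def n less_Suc_eq_le by blast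
  qed
  moreover have "inj_on ?f ?C" using assms by (intro inj_onI) simp
  ultimately show ?thesis
    using card_dvd_power_mixture[OF assms(1-3), of 1 m] by (simp only: card_image n mult_1)
qed

section \<open>The complexity and its generating function\<close>

lemma complexity_trace_subshift:
  assumes "p > 0" "q > 0" "coprime p q"
  shows "complexity (trace_subshift p q) n = word_count p q n"
\<comment> \<open>Length 0 is treated apart: there are no cell ends, yet the empty word
  counts.\<close>
proof (cases "n = 0")
  case True
  have "range (power_word p q 0) = {[]}" by (auto simp: power_word_def)
  with True show ?thesis by (simp add: complexity_def words_of_trace_subshift[OF assms(1,2)])
next
  case False
  then show ?thesis
    using assms by (simp add: complexity_def words_of_trace_subshift range_power_word card_image
        inj_on_power_word card_cell_ends)
qed

theorem theorem4p2:
  fixes p q :: nat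
  assumes "coprime p q" and "1 < q" and "q < p"
  shows "(Abs_fps (\<lambda>n. of_nat (complexity (trace_subshift p q) n)) :: rat fps) =
    (1 + fps_const (of_nat p * of_nat q - of_nat p - of_nat q) * fps_X) /
    ((1 - fps_const (of_nat p) * fps_X) * (1 - fps_const (of_nat q) * fps_X))"
proof -
  let ?P = "fps_const (of_nat p) * fps_X :: rat fps" and ?Q = "fps_const (of_nat q) * fps_X :: rat fps"
  define F where "F = (Abs_fps (\<lambda>n. of_nat (complexity (trace_subshift p q) n)) :: rat fps)"
  have F: "fps_nth F n = of_nat (word_count p q n)" for n
    using assms by (simp add: F_def complexity_trace_subshift)
  \<comment> \<open>The factor \<open>1 - ?Q\<close> turns the recurrence into coefficients that are
    geometric with ratio \<open>p\<close> from degree 1 on.\<close>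
  have FQ: "fps_nth (F * (1 - ?Q)) n = (case n of 0 \<Rightarrow> 1 | Suc k \<Rightarrow> of_nat q * (of_nat p - 1) * of_nat p ^ k)" for n
  proof -
    have "F * (1 - ?Q) = F - fps_const (of_nat q) * (fps_X * F)" by (simp add: algebra_simps)
    moreover have "of_nat (p - 1) = (of_nat p - 1 :: rat)"
      using assms by (simp add: of_nat_diff)
    ultimately show ?thesis
      by (simp add: F mult.assoc split: nat.split)
  qed
  \<comment> \<open>The factor \<open>1 - ?P\<close> cancels the geometric tail. Degree 1 keeps
    \<open>q * (p - 1) - p\<close>, because the coefficient 1 in degree 0 lies outside the geometric
    pattern.\<close>
  have "F * (1 - ?Q) * (1 - ?P) = 1 + fps_const (of_nat p * of_nat q - of_nat p - of_nat q) * fps_X"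
  proof (rule fps_ext)
    fix n
    have "F * (1 - ?Q) * (1 - ?P) = F * (1 - ?Q) - fps_const (of_nat p) * (fps_X * (F * (1 - ?Q)))"
      by (simp add: algebra_simps)
    then have *: "fps_nth (F * (1 - ?Q) * (1 - ?P)) n =
        fps_nth (F * (1 - ?Q)) n - of_nat p * (if n = 0 then 0 else fps_nth (F * (1 - ?Q)) (n - 1))"
      by simp
    show "fps_nth (F * (1 - ?Q) * (1 - ?P)) n =
        fps_nth (1 + fps_const (of_nat p * of_nat q - of_nat p - of_nat q) * fps_X) n"
      unfolding * FQ by (auto simp: algebra_simps fps_X_def split: nat.split)
  qed
  then have "F * ((1 - ?P) * (1 - ?Q)) = 1 + fps_const (of_nat p * of_nat q - of_nat p - of_nat q) * fps_X"
    by (simp only: mult_ac)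
  moreover have "(1 - ?P) * (1 - ?Q) \<noteq> 0"
  proof
    assume "(1 - ?P) * (1 - ?Q) = 0"
    then have "fps_nth ((1 - ?P) * (1 - ?Q)) 0 = 0" by (simp only: fps_zero_nth)
    then show False by simp
  qed
  ultimately have "F = (1 + fps_const (of_nat p * of_nat q - of_nat p - of_nat q) * fps_X) / ((1 - ?P) * (1 - ?Q))"
    by (metis nonzero_mult_div_cancel_right)
  then show ?thesis by (simp add: F_def)
qed

end
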